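(* Let $q$ be a prime power, $P$ a finite poset and $k\ge 2$ a fixed integer. Then for all sufficiently large $n$, \[ \mathrm{La}_q(n,P)\le\frac{1}{2^{k-1}}\Big(|P|+(3k-5)2^{k-2}(h(P)-1)-1\Big)\begin{bmatrix} n\\ \lfloor n/2\rfloor\end{bmatrix}_q . \]
   Context: $|P|$ is the number of elements of $P$ and $h(P)$ is the number of elements in a longest chain of $P$. A poset $P$ is a subposet of $Q$ if there is an injection $\phi:P\to Q$ with $x\le_P y\Rightarrow\phi(x)\le_Q\phi(y)$. $\mathrm{La}_q(n,P)$ is the maximum size of a family of subspaces (ordered by inclusion) of an $n$-dimensional vector space over $\mathbb{F}_q$ not containing $P$ as a subposet. $\begin{bmatrix} n\\ k\end{bmatrix}_q=\prod_{0\le i<k}\frac{q^{n-i}-1}{q^{k-i}-1}$. *)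

theory Defs
  imports
    "HOL-Library.Function_Algebras"
    "HOL-Library.Cardinality"
    Complex_Main
    "HOL-Number_Theory.Prime_Powers"
begin

text \<open>Since the dimension has to vary inside a formula, the space \<open>K\<^sup>n\<close> over a field \<open>K\<close> is
  realised as the set of functions \<open>nat \<Rightarrow> K\<close> that vanish from index \<open>n\<close> on.\<close>

definition fscale :: "'a::field \<Rightarrow> (nat \<Rightarrow> 'a) \<Rightarrow> nat \<Rightarrow> 'a" where
  "fscale c v = (\<lambda>i. c * v i)"

global_interpretation fvec: vector_space "fscale :: 'a::field \<Rightarrow> (nat \<Rightarrow> 'a) \<Rightarrow> nat \<Rightarrow> 'a"
  by unfold_locales (auto simp: fscale_def fun_eq_iff algebra_simps)

definition coord_space :: "nat \<Rightarrow> (nat \<Rightarrow> 'a::field) set" where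
  "coord_space n = {v. \<forall>i\<ge>n. v i = 0}"

definition subspaces :: "nat \<Rightarrow> (nat \<Rightarrow> 'a::field) set set" where
  "subspaces n = {W. fvec.subspace W \<and> W \<subseteq> coord_space n}"

text \<open>A poset is a carrier set \<open>A\<close> with a relation \<open>r\<close> such that \<open>partial_order_on A r\<close>. The notion
  of subposet is the non-induced one: comparabilities are preserved but need not be reflected.\<close>

definition is_subposet :: "'p set \<Rightarrow> 'p rel \<Rightarrow> 'b set \<Rightarrow> 'b rel \<Rightarrow> bool" where
  "is_subposet A r B s \<longleftrightarrow>
     (\<exists>\<phi>. inj_on \<phi> A \<and> \<phi> ` A \<subseteq> B \<and> (\<forall>x\<in>A. \<forall>y\<in>A. (x, y) \<in> r \<longrightarrow> (\<phi> x, \<phi> y) \<in> s))"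

definition height :: "'p set \<Rightarrow> 'p rel \<Rightarrow> nat" where
  "height A r = Max (card ` {C. C \<subseteq> A \<and> C \<in> Chains r})"

text \<open>The maximum below is over a finite set, which is nonempty whenever \<open>A\<close> is: then the empty
  family qualifies.\<close>

definition La :: "'a::{field,finite} itself \<Rightarrow> nat \<Rightarrow> 'p set \<Rightarrow> 'p rel \<Rightarrow> nat" where
  "La K n A r = Max {card F | F :: (nat \<Rightarrow> 'a) set set.
     F \<subseteq> subspaces n \<and> \<not> is_subposet A r F (relation_of (\<subseteq>) F)}"

definition gauss_binomial :: "nat \<Rightarrow> nat \<Rightarrow> nat \<Rightarrow> real" where
  "gauss_binomial q n k =
     (\<Prod>i<k. (real q ^ (n - i) - 1) / (real q ^ (k - i) - 1))"

lemma subspace_coord_space: "fvec.subspace (coord_space n)"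
  by (auto simp: fvec.subspace_def coord_space_def fscale_def)

lemma dim_coord_space: "fvec.dim (coord_space n :: (nat \<Rightarrow> 'a::field) set) = n"
proof -
  define e :: "nat \<Rightarrow> nat \<Rightarrow> 'a" where "e i = (\<lambda>j. if j = i then 1 else 0)" for i
  have inj: "inj_on e {..<n}"
    by (auto simp: inj_on_def e_def fun_eq_iff)
  have sum_e: "(\<Sum>i<n. fscale (c i) (e i)) j = (if j < n then c j else 0)" for c j
  proof -
    have "(\<Sum>i\<in>I. fscale (c i) (e i)) j = (\<Sum>i\<in>I. c i * e i j)" if "finite I" for I :: "nat set"
      using that by (induction I) (auto simp: fscale_def)
    then show ?thesis
      by (simp add: e_def if_distrib cong: if_cong)
  qed
  show ?thesis
  proof (rule fvec.dim_unique[of "e ` {..<n}"])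
    show "e ` {..<n} \<subseteq> coord_space n"
      by (auto simp: e_def coord_space_def)
    show "coord_space n \<subseteq> fvec.span (e ` {..<n})"
    proof
      fix v :: "nat \<Rightarrow> 'a" assume "v \<in> coord_space n"
      then have "v = (\<Sum>i<n. fscale (v i) (e i))"
        by (auto simp: sum_e coord_space_def)
      also have "\<dots> \<in> fvec.span (e ` {..<n})"
        by (intro fvec.span_sum fvec.span_scale fvec.span_base) auto
      finally show "v \<in> fvec.span (e ` {..<n})" .
    qed
    show "fvec.independent (e ` {..<n})"
    proof (rule fvec.independent_if_scalars_zero)
      fix f x assume *: "(\<Sum>x\<in>e ` {..<n}. fscale (f x) x) = 0" and x: "x \<in> e ` {..<n}"
      then obtain i where i: "i < n" "x = e i" by auto
      have "(\<Sum>i<n. fscale (f (e i)) (e i)) = 0"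
        using * by (simp add: sum.reindex[OF inj])
      then show "f x = 0"
        using sum_e[of "\<lambda>i. f (e i)" i] i by simp
    qed simp
    show "card (e ` {..<n}) = n"
      by (simp add: card_image[OF inj])
  qed
qed

lemma finite_coord_space: "finite (coord_space n :: (nat \<Rightarrow> 'a::{field,finite}) set)"
proof (rule finite_subset)
  show "coord_space n \<subseteq> {f :: nat \<Rightarrow> 'a. \<forall>i. (i \<in> {..<n} \<longrightarrow> f i \<in> UNIV) \<and> (i \<notin> {..<n} \<longrightarrow> f i = 0)}"
    by (auto simp: coord_space_def)
  show "finite {f :: nat \<Rightarrow> 'a. \<forall>i. (i \<in> {..<n} \<longrightarrow> f i \<in> UNIV) \<and> (i \<notin> {..<n} \<longrightarrow> f i = 0)}"
    by (rule finite_set_of_finite_funs) auto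
qed

lemma finite_subspaces: "finite (subspaces n :: (nat \<Rightarrow> 'a::{field,finite}) set set)"
  by (rule finite_subset[OF _ finite_Pow_iff[THEN iffD2, OF finite_coord_space]])
    (auto simp: subspaces_def)

end

theory Submission
  imports Defs "HOL-Library.FuncSet"
begin

text \<open>A basis \<open>v\<^sub>0, \<dots>, v\<^sub>n\<^sub>-\<^sub>1\<close> of the space embeds the Boolean lattice into the lattice of subspaces, via
  \<open>X \<mapsto> span {v\<^sub>i. i \<in> X}\<close>. Inside the Boolean lattice consider the sets lying in some interval between
  \<open>{..<i}\<close> and \<open>{..<i + k}\<close>; there are \<open>2\<^sup>k\<^sup>-\<^sup>1\<close> of them on every level that is not close to the top or the
  bottom. Order them by their largest element. At most \<open>(3k - 5) 2\<^sup>k\<^sup>-\<^sup>2\<close> sets following a given one fail to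
  contain all the sets before it. Hence a subfamily with at least \<open>|P| + (3k - 5) 2\<^sup>k\<^sup>-\<^sup>2 (h(P) - 1)\<close>
  members contains \<open>P\<close>: split \<open>P\<close> into \<open>h(P)\<close> antichains by rank, embed the lowest one into the first
  members, drop the members that are not above all of these, and continue. Averaging over all ordered
  bases turns this into the bound; a \<open>j\<close>-dimensional subspace is hit by a fixed \<open>j\<close>-set of basis vectors
  with probability 1 over the Gaussian binomial coefficient. The outer levels carry too few sets, but
  there the Gaussian binomials are smaller than the middle one by a large factor.\<close>

subsection \<open>Greedy embeddings\<close>

text \<open>The rank of x is the largest size of a chain strictly below x. Adding x to such a chain
  gives a chain of A, hence the bound by the height; it also gives a chain strictly below every y
  above x, hence the strict growth.\<close>

lemma height_rank:
  assumes "finite A" "partial_order_on A r"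
  obtains \<rho> :: "'p \<Rightarrow> nat" where "\<And>x. x \<in> A \<Longrightarrow> \<rho> x < height A r"
    and "\<And>x y. x \<in> A \<Longrightarrow> y \<in> A \<Longrightarrow> (x, y) \<in> r \<Longrightarrow> x \<noteq> y \<Longrightarrow> \<rho> x < \<rho> y"
proof -
  define below where "below x = {C. C \<subseteq> A \<and> C \<in> Chains r \<and> (\<forall>z\<in>C. (z, x) \<in> r \<and> z \<noteq> x)}" for x
  define \<rho> where "\<rho> x = Max (card ` below x)" for x
  have refl: "(x, x) \<in> r" if "x \<in> A" for x
    using assms that by (auto simp: partial_order_on_def preorder_on_def refl_on_def)
  have trans: "(x, z) \<in> r" if "(x, y) \<in> r" "(y, z) \<in> r" for x y z
    using assms that by (meson partial_order_onD(2) transD)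
  have antisym: "x = y" if "(x, y) \<in> r" "(y, x) \<in> r" for x y
    using assms that by (meson partial_order_onD(3) antisymD)
  have fin: "finite (below x)" for x
    by (rule finite_subset[of _ "Pow A"]) (auto simp: below_def assms)
  have le: "card C \<le> \<rho> x" if "C \<in> below x" for C x
    unfolding \<rho>_def using that fin by simp
  have ex: "\<exists>C\<in>below x. card C = \<rho> x" for x
  proof -
    have "{} \<in> below x" by (auto simp: below_def Chains_def)
    then have "\<rho> x \<in> card ` below x"
      unfolding \<rho>_def using fin by (intro Max_in) auto
    then show ?thesis by auto
  qed
  have ins: "insert x C \<subseteq> A \<and> insert x C \<in> Chains r \<and> card (insert x C) = Suc (card C)"
    if "C \<in> below x" "x \<in> A" for x C
  proof -
    have "finite C" using that assms by (auto simp: below_def intro: finite_subset)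
    then show ?thesis using that refl by (auto simp: below_def Chains_def)
  qed
  show thesis
  proof
    fix x assume x: "x \<in> A"
    obtain C where C: "C \<in> below x" "card C = \<rho> x" using ex by blast
    have "card (insert x C) \<le> height A r"
      unfolding height_def using ins[OF C(1) x] assms(1) by (intro Max_ge imageI) auto
    then show "\<rho> x < height A r" using ins[OF C(1) x] C by simp
  next
    fix x y assume xy: "x \<in> A" "y \<in> A" "(x, y) \<in> r" "x \<noteq> y"
    obtain C where C: "C \<in> below x" "card C = \<rho> x" using ex by blast
    have "(z, y) \<in> r \<and> z \<noteq> y" if "z \<in> insert x C" for z
    proof (cases "z = x")
      case False
      then have "(z, x) \<in> r" using C(1) that by (auto simp: below_def)
      then show ?thesis using trans[OF _ xy(3)] antisym[OF xy(3)] xy(4) by blast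
    qed (use xy in simp)
    then have "insert x C \<in> below y"
      using ins[OF C(1) xy(1)] by (simp add: below_def)
    then show "\<rho> x < \<rho> y" using le ins[OF C(1) xy(1)] C(2) by fastforce
  qed
qed

text \<open>Since \<open>key\<close> may have ties, the first a members are not determined; S grows
  by repeatedly adding a remaining member of minimal key.\<close>

lemma initial_subset_exists:
  fixes key :: "'b \<Rightarrow> nat"
  assumes "finite G" "a \<le> card G"
  obtains S where "S \<subseteq> G" "card S = a" "\<And>x y. x \<in> S \<Longrightarrow> y \<in> G - S \<Longrightarrow> key x \<le> key y"
proof -
  have "\<exists>S\<subseteq>G. card S = a \<and> (\<forall>x\<in>S. \<forall>y\<in>G - S. key x \<le> key y)"
    using assms(2)
  proof (induction a)
    case 0
    then show ?case by (intro exI[of _ "{}"]) auto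
  next
    case (Suc a)
    then obtain S where S: "S \<subseteq> G" "card S = a" "\<forall>x\<in>S. \<forall>y\<in>G - S. key x \<le> key y" by auto
    have "G - S \<noteq> {}" using S Suc.prems assms(1) by (metis card_mono Diff_eq_empty_iff not_less_eq_eq finite_subset)
    then obtain x where x: "x \<in> G - S" "\<And>y. y \<in> G - S \<Longrightarrow> key x \<le> key y"
      using arg_min_if_finite[of "G - S" key] assms(1) by (meson finite_Diff not_le)
    have "finite S" using S assms(1) finite_subset by auto
    then show ?case using S x by (intro exI[of _ "insert x S"]) auto
  qed
  then show thesis using that by blast
qed

text \<open>Induction on h, placing the elements of rank 0 first and moving the others into the
  members above all of these. The last rank needs no room above it, so the h + 1 possible ranks cost
  only h times the discard D.\<close>

lemma greedy_embedding:
  fixes key :: "'b \<Rightarrow> nat" and \<rho> :: "'p \<Rightarrow> nat"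
  assumes C: "finite C"
    and bad: "\<And>x. x \<in> C \<Longrightarrow>
      card {y \<in> C - {x}. key x \<le> key y \<and> \<not> (\<forall>z\<in>C. key z \<le> key x \<longrightarrow> le z y)} \<le> D"
    and "finite A" "G \<subseteq> C" "\<And>x. x \<in> A \<Longrightarrow> \<rho> x \<le> h" "card A + D * h \<le> card G"
  shows "\<exists>\<phi>. inj_on \<phi> A \<and> \<phi> ` A \<subseteq> G \<and> (\<forall>x\<in>A. \<forall>y\<in>A. \<rho> x < \<rho> y \<longrightarrow> le (\<phi> x) (\<phi> y))"
  using assms(3-)
proof (induction h arbitrary: A G \<rho>)
  case 0
  then have "finite G" using C finite_subset by blast
  then obtain \<phi> where "inj_on \<phi> A" "\<phi> ` A \<subseteq> G"
    using card_le_inj[of A G] 0 by auto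
  then show ?case using 0 by fastforce
next
  case (Suc h)
  have finG: "finite G" using C Suc.prems finite_subset by blast
  define A0 where "A0 = {x \<in> A. \<rho> x = 0}"
  have A0: "A0 \<subseteq> A" "finite A0" "card A0 \<le> card A"
    using Suc.prems by (auto simp: A0_def intro: card_mono)
  have cA0: "card A0 \<le> card G" using A0 Suc.prems(4) by linarith
  obtain S where S: "S \<subseteq> G" "card S = card A0"
    "\<And>x y. x \<in> S \<Longrightarrow> y \<in> G - S \<Longrightarrow> key x \<le> key y"
    using initial_subset_exists[OF finG cA0, of key] by metis
  have finS: "finite S" using S finG finite_subset by blast
  define T where "T = {y \<in> G - S. \<forall>x\<in>S. le x y}"
  have "card (G - S - T) \<le> D"
  proof (cases "S = {}")
    case True
    then show ?thesis by (simp add: T_def)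
  next
    case False
    \<comment> \<open>x is a last member of S: all of S has key at most that of x, and the rest of G
      has key at least that. So the dropped members are among those that \<open>bad\<close> counts
      at x.\<close>
    then obtain x where x: "x \<in> S" "\<And>z. z \<in> S \<Longrightarrow> key z \<le> key x"
      using Max_in[of "key ` S"] Max_ge[of "key ` S"] finS by (metis (no_types, lifting) finite_imageI imageE image_eqI image_is_empty)
    have "G - S - T \<subseteq> {y \<in> C - {x}. key x \<le> key y \<and> \<not> (\<forall>z\<in>C. key z \<le> key x \<longrightarrow> le z y)}"
      using x S Suc.prems(2) unfolding T_def by blast
    then have "card (G - S - T) \<le> card \<dots>"
      using C by (intro card_mono) auto
    also have "\<dots> \<le> D" using bad x S Suc.prems by blast
    finally show ?thesis .
  qed
  moreover have "card G = card S + card (G - S - T) + card T"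
  proof -
    have T: "T \<subseteq> G - S" by (auto simp: T_def)
    have "card G = card S + card (G - S)"
      using card_Diff_subset[OF finS S(1)] card_mono[OF finG S(1)] by linarith
    moreover have "card (G - S) = card (G - S - T) + card T"
      using card_Diff_subset[of T "G - S"] card_mono[of "G - S" T] T finG finite_subset by fastforce
    ultimately show ?thesis by linarith
  qed
  ultimately have cT: "card (A - A0) + D * h \<le> card T"
    using Suc.prems(4) S(2) card_Diff_subset[OF A0(2,1)] A0(3) by (simp add: algebra_simps)
  \<comment> \<open>Ranks outside \<open>A0\<close> are positive, so lowering them by 1 keeps their
    strict order in spite of truncated subtraction.\<close>
  have "\<exists>\<phi>. inj_on \<phi> (A - A0) \<and> \<phi> ` (A - A0) \<subseteq> T \<and>
      (\<forall>x\<in>A - A0. \<forall>y\<in>A - A0. \<rho> x - 1 < \<rho> y - 1 \<longrightarrow> le (\<phi> x) (\<phi> y))"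
  proof (rule Suc.IH)
    show "\<rho> x - 1 \<le> h" if "x \<in> A - A0" for x using Suc.prems(3)[of x] that by auto
    show "finite (A - A0)" using Suc.prems(1) by simp
    show "T \<subseteq> C" using Suc.prems(2) by (auto simp: T_def)
  qed (rule cT)
  then obtain \<phi> where \<phi>: "inj_on \<phi> (A - A0)" "\<phi> ` (A - A0) \<subseteq> T"
      "\<forall>x\<in>A - A0. \<forall>y\<in>A - A0. \<rho> x - 1 < \<rho> y - 1 \<longrightarrow> le (\<phi> x) (\<phi> y)" by blast
  obtain \<psi> where \<psi>: "bij_betw \<psi> A0 S"
    using finite_same_card_bij[OF A0(2) finS] S(2) by auto
  define \<chi> where "\<chi> x = (if x \<in> A0 then \<psi> x else \<phi> x)" for x
  have \<psi>S: "\<psi> x \<in> S" if "x \<in> A0" for x using \<psi> that by (auto simp: bij_betw_def)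
  have \<phi>T: "\<phi> x \<in> T" if "x \<in> A" "x \<notin> A0" for x using \<phi> that by auto
  have ST: "S \<inter> T = {}" by (auto simp: T_def)
  show ?case
  proof (intro exI conjI ballI impI)
    show "inj_on \<chi> A"
    proof (rule inj_onI)
      fix x y assume xy: "x \<in> A" "y \<in> A" "\<chi> x = \<chi> y"
      then have "x \<in> A0 \<longleftrightarrow> y \<in> A0"
        using \<psi>S[of x] \<psi>S[of y] \<phi>T[of x] \<phi>T[of y] ST by (auto simp: \<chi>_def split: if_splits)
      then show "x = y"
        using xy \<phi>(1) bij_betw_imp_inj_on[OF \<psi>] by (auto simp: \<chi>_def inj_on_def split: if_splits)
    qed
    show "\<chi> ` A \<subseteq> G"
      using \<psi>S \<phi>T S(1) by (auto simp: \<chi>_def T_def)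
  next
    fix x y assume xy: "x \<in> A" "y \<in> A" "\<rho> x < \<rho> y"
    then have y: "y \<in> A - A0" by (auto simp: A0_def)
    show "le (\<chi> x) (\<chi> y)"
    proof (cases "x \<in> A0")
      case True
      then show ?thesis using y \<psi>S[OF True] \<phi>T[of y] by (auto simp: \<chi>_def T_def)
    next
      case False
      then have "\<rho> x - 1 < \<rho> y - 1" using xy by (auto simp: A0_def)
      then show ?thesis using False y xy \<phi>(3) by (auto simp: \<chi>_def)
    qed
  qed
qed

subsection \<open>Interval chains\<close>

text \<open>The pair \<open>(m, B)\<close> encodes the set whose least missing element is \<open>m\<close>, with \<open>B\<close> describing what
  lies beyond \<open>m\<close>. Bounding \<open>B\<close> by \<open>k - 1\<close> says that the set lies between \<open>{..<m}\<close> and \<open>{..<m + k}\<close>.\<close>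

definition pset :: "nat \<times> nat set \<Rightarrow> nat set" where
  "pset p = {..<fst p} \<union> (\<lambda>b. fst p + 1 + b) ` snd p"

definition interval_chain :: "nat \<Rightarrow> nat \<Rightarrow> (nat \<times> nat set) set" where
  "interval_chain k n = {p. snd p \<subseteq> {..<k - 1} \<and> pset p \<subseteq> {..<n}}"

text \<open>The least t such that the encoded set lies in \<open>{..<t}\<close>: one more than its
  largest element, and 0 for the empty set.\<close>

definition top_pos :: "nat \<times> nat set \<Rightarrow> nat" where
  "top_pos p = (if snd p = {} then fst p else fst p + 2 + Max (snd p))"

lemma inj_pset: "inj pset"
proof (rule injI)
  fix p p' assume eq: "pset p = pset p'"
  have m: "fst p = (LEAST i. i \<notin> pset p)" for p
    by (rule Least_equality[symmetric]) (auto simp: pset_def not_le[symmetric])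
  have B: "snd p = {b. fst p + 1 + b \<in> pset p}" for p
    by (auto simp: pset_def)
  have "fst p = fst p'" using m[of p] m[of p'] eq by simp
  then show "p = p'" using B[of p] B[of p'] eq by (simp add: prod_eq_iff)
qed

lemma finite_interval_chain: "finite (interval_chain k n)"
proof (rule finite_subset)
  show "interval_chain k n \<subseteq> {..n} \<times> Pow {..<k - 1}"
    by (auto simp: interval_chain_def pset_def)
qed simp

lemma card_pset: "finite (snd p) \<Longrightarrow> card (pset p) = fst p + card (snd p)"
  unfolding pset_def by (subst card_Un_disjoint) (auto simp: card_image inj_on_def)

lemma pset_subset_pset:
  assumes "finite (snd p)" "top_pos p \<le> fst p'"
  shows "pset p \<subseteq> pset p'"
proof -
  have "i < top_pos p" if i: "i \<in> pset p" for i
  proof (cases "i < fst p")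
    case False
    then obtain b where b: "b \<in> snd p" "i = fst p + 1 + b" using i unfolding pset_def by blast
    then show ?thesis using Max_ge[OF assms(1), of b] by (auto simp: top_pos_def)
  qed (auto simp: top_pos_def)
  then show ?thesis using assms(2) by (force simp: pset_def)
qed

text \<open>The initial segment \<open>(j, {})\<close> always lies on level j. Away from both ends
  every pattern B contributes one set, the one starting at \<open>j - card B\<close>:
  \<open>k \<le> j\<close> prevents truncation and \<open>j + k \<le> n\<close> keeps the set inside
  \<open>{..<n}\<close>.\<close>

lemma card_level_interval_chain:
  assumes "j \<le> n"
  shows "1 \<le> card {p \<in> interval_chain k n. card (pset p) = j}"
    and "k \<ge> 1 \<Longrightarrow> k \<le> j \<Longrightarrow> j + k \<le> n \<Longrightarrow> 2 ^ (k - 1) \<le> card {p \<in> interval_chain k n. card (pset p) = j}"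
proof -
  let ?L = "{p \<in> interval_chain k n. card (pset p) = j}"
  have fin: "finite ?L" using finite_interval_chain by simp
  have "(j, {}) \<in> ?L" using assms by (auto simp: interval_chain_def pset_def)
  then have "card ?L > 0" using fin card_gt_0_iff by blast
  then show "1 \<le> card ?L" by simp
  assume k: "k \<ge> 1" "k \<le> j" "j + k \<le> n"
  have "(\<lambda>B. (j - card B, B)) ` Pow {..<k - 1} \<subseteq> ?L"
  proof safe
    fix B assume B: "B \<subseteq> {..<k - 1}"
    then have "card B \<le> k - 1" "finite B" using card_mono[of "{..<k - 1}" B] finite_subset[of B] by auto
    then show "card (pset (j - card B, B)) = j" using k by (simp add: card_pset)
    show "(j - card B, B) \<in> interval_chain k n"
      using B k by (auto simp: interval_chain_def pset_def)
  qed
  then have "card ((\<lambda>B. (j - card B, B)) ` Pow {..<k - 1}) \<le> card ?L"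
    by (rule card_mono[OF fin])
  then show "2 ^ (k - 1) \<le> card ?L"
    by (subst (asm) card_image) (auto simp: inj_on_def card_Pow)
qed

text \<open>Among the sets with the same largest element the initial segment comes last. This tie-breaking
  accounts for the final \<open>- 1\<close> in \<open>card_not_above_le\<close>, which is needed for \<open>k = 2\<close> and \<open>k = 3\<close>.\<close>

definition chain_key :: "nat \<times> nat set \<Rightarrow> nat" where
  "chain_key p = 2 * top_pos p + (if snd p = {} then 1 else 0)"

text \<open>Let t be \<open>top_pos x\<close>. A counted y starts before t, since otherwise it would
  contain \<open>{..<t}\<close> and with it every z in question, and it does not end before x does.
  So \<open>snd y\<close> is one of the 2 ^ (k - 1) - 1 nonempty patterns, and \<open>fst y\<close>
  is one of at most k numbers just below t.\<close>

lemma card_not_above_le: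
  assumes k: "k \<ge> 2" and x: "x \<in> interval_chain k n"
  shows "card {y \<in> interval_chain k n - {x}. chain_key x \<le> chain_key y \<and>
      \<not> (\<forall>z\<in>interval_chain k n. chain_key z \<le> chain_key x \<longrightarrow> pset z \<subseteq> pset y)}
    \<le> k * (2 ^ (k - 1) - 1) - 1" (is "card ?Bad \<le> _")
proof -
  define S where "S = ?Bad"
  define t where "t = top_pos x"
  \<comment> \<open>The sets counted are coded injectively by elements of \<open>R\<close>, and the code of at least one element is missed.\<close>
  define code where "code y = (snd y, t - 1 - fst y)" for y :: "nat \<times> nat set"
  define R where "R = (Pow {..<k - 1} - {{}}) \<times> {..<k}"
  define U where "U = {y. snd y \<noteq> {} \<and> snd y \<subseteq> {..<k - 1} \<and> fst y < t \<and> t \<le> top_pos y}"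
  have finB: "finite B" if "B \<subseteq> {..<k - 1}" for B using that finite_subset by blast
  have code_R: "code y \<in> R" if "y \<in> U" for y
  proof -
    have "Max (snd y) < k - 1" using that finB Max_in[of "snd y"] by (auto simp: U_def)
    moreover have "snd y \<noteq> {}" "t \<le> fst y + 2 + Max (snd y)"
      using that unfolding U_def top_pos_def by (force, force)
    ultimately have "t - 1 - fst y < k" by linarith
    then show ?thesis using that by (auto simp: U_def R_def code_def)
  qed
  have inj: "inj_on code U" 
  proof (rule inj_onI)
    fix y y' assume "y \<in> U" "y' \<in> U" "code y = code y'"
    then have "fst y < t" "fst y' < t" "t - 1 - fst y = t - 1 - fst y'" "snd y = snd y'"
      by (simp_all add: U_def code_def)
    then show "y = y'" by (simp add: prod_eq_iff)
  qed
  have "finite R" by (simp add: R_def)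
  have cR: "card R = k * (2 ^ (k - 1) - 1)"
    by (simp add: R_def card_cartesian_product card_Diff_subset card_Pow)
  have Bad: "y \<in> U \<and> y \<noteq> x \<and> (snd x = {} \<longrightarrow> t < top_pos y)" if yS: "y \<in> S" for y
  proof -
    have y: "y \<in> interval_chain k n" "y \<noteq> x" "chain_key x \<le> chain_key y"
      using yS by (auto simp: S_def)
    obtain z where z: "z \<in> interval_chain k n" "chain_key z \<le> chain_key x" "\<not> pset z \<subseteq> pset y"
      using yS unfolding S_def by blast
    have "top_pos z \<le> t" using z(2) by (auto simp: chain_key_def t_def split: if_splits)
    moreover have "finite (snd z)" using z finB by (auto simp: interval_chain_def)
    ultimately have lt: "fst y < t" using z(3) pset_subset_pset[of z y] by linarith
    have ge: "t \<le> top_pos y" using y(3) by (auto simp: chain_key_def t_def split: if_splits)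
    have ne: "snd y \<noteq> {}" using lt ge by (auto simp: top_pos_def)
    have "snd x = {} \<longrightarrow> t < top_pos y" using y(3) ne by (auto simp: chain_key_def t_def)
    then show ?thesis using lt ge ne y by (auto simp: U_def interval_chain_def)
  qed
  \<comment> \<open>If x is an initial segment, the tie-breaking forces
    \<open>t < top_pos y\<close>, which excludes the pattern {0} started at t - 2, whose
    \<open>top_pos\<close> is exactly t. Any other x lies in U but not in S, so its own code is
    free.\<close>
  have "\<exists>c\<in>R. c \<notin> code ` S"
  proof (cases "snd x = {}")
    case True
    have "({0}, 1) \<in> R" using k by (auto simp: R_def)
    moreover have "({0}, 1) \<notin> code ` S"
    proof
      assume "({0}, 1) \<in> code ` S"
      then obtain y where y: "y \<in> S" "snd y = {0}" "t - 1 - fst y = 1" by (auto simp: code_def)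
      with Bad[OF y(1)] True show False by (auto simp: top_pos_def U_def)
    qed
    ultimately show ?thesis by blast
  next
    case False
    then have "x \<in> U" using x by (auto simp: U_def t_def top_pos_def interval_chain_def)
    have "code x \<notin> code ` S"
    proof
      assume "code x \<in> code ` S"
      then obtain y where "y \<in> S" "code x = code y" by auto
      then show False using Bad[of y] \<open>x \<in> U\<close> inj_onD[OF inj, of x y] by blast
    qed
    then show ?thesis using code_R \<open>x \<in> U\<close> by blast
  qed
  then obtain c where c: "c \<in> R" "c \<notin> code ` S" by blast
  have "S \<subseteq> U" using Bad by blast
  then have "card S = card (code ` S)"
    using card_image inj_on_subset[OF inj] by metis
  also have "\<dots> \<le> card (R - {c})"
  proof (rule card_mono)
    show "code ` S \<subseteq> R - {c}" using c Bad code_R by blast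
  qed (use \<open>finite R\<close> in simp)
  also have "\<dots> = k * (2 ^ (k - 1) - 1) - 1" using c \<open>finite R\<close> cR by simp
  finally show ?thesis by (simp only: S_def)
qed

text \<open>With k = l + 2 the right side exceeds the left by (l - 3) * 2 ^ l + l + 3. This is 0 for
  l = 0 and l = 1, it is 1 for l = 2, and from l = 3 on every term is nonnegative.\<close>

lemma discard_bound:
  assumes "k \<ge> 2"
  shows "real (k * (2 ^ (k - 1) - 1) - 1) \<le> (3 * real k - 5) * 2 ^ (k - 2)"
proof -
  obtain l where l: "k = l + 2" using assms by (metis le_add_diff_inverse2)
  \<comment> \<open>Positivity turns the truncated subtraction of 1 into a real one.\<close>
  have "1 * 1 \<le> k * (2 ^ (k - 1) - 1)"
  proof (rule mult_le_mono)
    have "(2 :: nat) ^ (k - 1) = 2 * 2 ^ l" by (simp add: l)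
    then show "1 \<le> (2 :: nat) ^ (k - 1) - 1" using one_le_power[of "2 :: nat" l] by linarith
  qed (use assms in simp)
  then have "real (k * (2 ^ (k - 1) - 1) - 1) = real k * (2 * 2 ^ l - 1) - 1"
    by (simp add: of_nat_diff l del: mult_Suc)
  moreover have "real k * (2 * 2 ^ l - 1) - 1 \<le> (3 * real k - 5) * 2 ^ l"
  proof -
    consider "l = 0" | "l = 1" | "l = 2" | "l \<ge> 3" by linarith
    then show ?thesis
    proof cases
      case 4
      then have "3 * 2 ^ l \<le> real l * 2 ^ l" by (intro mult_right_mono) auto
      then have "3 * 2 ^ l \<le> real l + (3 + real l * 2 ^ l)" by linarith
      then show ?thesis by (simp add: l algebra_simps)
    qed (auto simp: l)
  qed
  ultimately show ?thesis by (simp add: l)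
qed

subsection \<open>Counting ordered bases\<close>

lemma card_span_independent:
  fixes S :: "(nat \<Rightarrow> 'a::{field,finite}) set"
  assumes "finite S" "fvec.independent S"
  shows "card (fvec.span S) = CARD('a) ^ card S"
  using assms
proof (induction S rule: finite_induct)
  case empty
  then show ?case by simp
next
  case (insert a S)
  then have S: "fvec.independent S" "a \<notin> fvec.span S"
    by (auto simp: fvec.independent_insert)
  let ?f = "\<lambda>(c, y). y + fscale c a"
  have "bij_betw ?f (UNIV \<times> fvec.span S) (fvec.span (insert a S))"
  proof (rule bij_betwI')
    fix p p' assume p: "p \<in> (UNIV :: 'a set) \<times> fvec.span S" "p' \<in> (UNIV :: 'a set) \<times> fvec.span S"
    have inj: "c = c'" if "y \<in> fvec.span S" "y' \<in> fvec.span S"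
      "y + fscale c a = y' + fscale c' a" for c c' y y'
    proof (rule ccontr)
      assume "c \<noteq> c'"
      have "fscale (c - c') a = y' - y"
        using that(3) by (simp add: fvec.scale_left_diff_distrib algebra_simps)
      also have "\<dots> \<in> fvec.span S" using that by (intro fvec.span_diff)
      finally have "fscale (inverse (c - c')) (fscale (c - c') a) \<in> fvec.span S"
        by (rule fvec.span_scale)
      then show False using S \<open>c \<noteq> c'\<close> by simp
    qed
    obtain c y c' y' where eq: "p = (c, y)" "p' = (c', y')" by (cases p, cases p')
    show "(?f p = ?f p') = (p = p')"
    proof
      assume "?f p = ?f p'"
      then have "y + fscale c a = y' + fscale c' a" by (simp add: eq)
      moreover from this have "c = c'" using p by (intro inj[of y y']) (simp_all add: eq)
      ultimately show "p = p'" by (simp add: eq)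
    qed simp
  next
    fix p assume "p \<in> (UNIV :: 'a set) \<times> fvec.span S"
    then show "?f p \<in> fvec.span (insert a S)"
      using fvec.span_mono[OF subset_insertI, of S a] fvec.span_base[of a "insert a S"]
      by (auto intro!: fvec.span_add fvec.span_scale)
  next
    fix v assume "v \<in> fvec.span (insert a S)"
    then obtain c where "v - fscale c a \<in> fvec.span S"
      using fvec.span_breakdown_eq by blast
    then show "\<exists>p\<in>UNIV \<times> fvec.span S. v = ?f p"
      by (intro bexI[of _ "(c, v - fscale c a)"]) auto
  qed
  then have "card (fvec.span (insert a S)) = card ((UNIV :: 'a set) \<times> fvec.span S)"
    by (simp add: bij_betw_same_card)
  then show ?case using insert S by (simp add: card_cartesian_product)
qed

lemma card_subspace:
  fixes W :: "(nat \<Rightarrow> 'a::{field,finite}) set"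
  assumes "finite W" "fvec.subspace W"
  shows "card W = CARD('a) ^ fvec.dim W"
proof -
  obtain B where B: "B \<subseteq> W" "fvec.independent B" "W \<subseteq> fvec.span B" "card B = fvec.dim W"
    using fvec.basis_exists by blast
  have "fvec.span B = W" using B assms by (meson fvec.span_minimal subset_antisym)
  then show ?thesis using card_span_independent[of B] B assms finite_subset by metis
qed

text \<open>Linearly independent families indexed by J; ordered bases when J has as many elements as
  V has dimensions. Injectivity is separate because independence of the image does not see repeated
  vectors, and extensionality makes equal families equal functions.\<close>

definition frames :: "(nat \<Rightarrow> 'a::field) set \<Rightarrow> 'i set \<Rightarrow> ('i \<Rightarrow> nat \<Rightarrow> 'a) set" where
  "frames V J = {f \<in> J \<rightarrow>\<^sub>E V. inj_on f J \<and> fvec.independent (f ` J)}"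

lemma finite_frames: "finite J \<Longrightarrow> finite V \<Longrightarrow> finite (frames V J)"
  unfolding frames_def by (rule finite_subset[OF _ finite_PiE[of J "\<lambda>_. V"]]) auto

text \<open>Indices are added to X one at a time: after i vectors, the next one is any vector
  outside their span, which has \<open>CARD('a) ^ i\<close> elements.\<close>

lemma card_frame_extensions:
  fixes V :: "(nat \<Rightarrow> 'a::{field,finite}) set"
  assumes V: "finite V" "fvec.subspace V" and g: "g \<in> frames V X"
    and "finite J" "X \<subseteq> J"
  shows "card {f \<in> frames V J. restrict f X = g} = (\<Prod>i\<in>{card X..<card J}. card V - CARD('a) ^ i)"
proof -
  let ?E = "\<lambda>Y. {f \<in> frames V (X \<union> Y). restrict f X = g}"
  have finX: "finite X" using assms finite_subset by blast
  have "card (?E Y) = (\<Prod>i\<in>{card X..<card X + card Y}. card V - CARD('a) ^ i)"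
    if "finite Y" "X \<inter> Y = {}" for Y
    using that
  proof (induction Y rule: finite_induct)
    case empty
    have "?E {} = {g}" using g by (auto simp: frames_def PiE_def extensional_restrict)
    then have 1: "card (?E {}) = 1" using card.insert[of "{}" g] by (simp only:) simp
    have 2: "(\<Prod>i\<in>{card X..<card X + card {}}. card V - CARD('a) ^ i) = 1" by simp
    show ?case unfolding 1 2 by (rule refl)
  next
    case (insert y Y)
    have y: "y \<notin> X \<union> Y" using insert.hyps insert.prems by auto
    have finY: "finite Y" "X \<inter> Y = {}" using insert.hyps insert.prems by auto
    have IH: "card (?E Y) = (\<Prod>i\<in>{card X..<card X + card Y}. card V - CARD('a) ^ i)"
      by (rule insert.IH[OF finY(2)])
    let ?J = "X \<union> Y"
    have J: "X \<union> insert y Y = insert y ?J" by auto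
    let ?S = "Sigma (?E Y) (\<lambda>f. V - fvec.span (f ` ?J))"
    have notin: "v \<notin> f ` ?J" if "v \<notin> fvec.span (f ` ?J)" for v f
      by (rule contra_subsetD[OF fvec.span_superset that])
    have upd_image: "(f(y := v)) ` ?J = f ` ?J" for f :: "'b \<Rightarrow> nat \<Rightarrow> 'a" and v
      using y by auto
    have "bij_betw (\<lambda>(f, v). f(y := v)) ?S (?E (insert y Y))"
    proof (rule bij_betw_byWitness[where f' = "\<lambda>h. (restrict h ?J, h y)"])
      show "\<forall>p\<in>?S. (\<lambda>h. (restrict h ?J, h y)) ((\<lambda>(f, v). f(y := v)) p) = p"
        using y by (force simp: frames_def PiE_def extensional_def restrict_def fun_eq_iff)
      show "\<forall>h\<in>?E (insert y Y). (\<lambda>(f, v). f(y := v)) (restrict h ?J, h y) = h"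
        using y by (force simp: frames_def PiE_def extensional_def restrict_def fun_eq_iff)
      show "(\<lambda>(f, v). f(y := v)) ` ?S \<subseteq> ?E (insert y Y)"
      proof safe
        fix f v assume f: "f \<in> frames V ?J" and v: "v \<in> V" "v \<notin> fvec.span (f ` ?J)"
        show "restrict (f(y := v)) X = restrict f X" using y by (auto simp: fun_eq_iff restrict_def)
        have im: "f(y := v) ` insert y ?J = insert v (f ` ?J)" 
          unfolding image_insert upd_image by simp
        show "f(y := v) \<in> frames V (X \<union> insert y Y)"
          unfolding J frames_def
        proof (intro CollectI conjI)
          show "f(y := v) \<in> insert y ?J \<rightarrow>\<^sub>E V" using f v by (auto simp: frames_def PiE_def extensional_def)
          show "inj_on (f(y := v)) (insert y ?J)"
            using f notin[OF v(2)] y by (auto simp: frames_def inj_on_def)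
          show "fvec.independent (f(y := v) ` insert y ?J)"
            unfolding im using f v by (auto simp: frames_def fvec.independent_insert)
        qed
      qed
      show "(\<lambda>h. (restrict h ?J, h y)) ` ?E (insert y Y) \<subseteq> ?S"
      proof safe
        fix h assume h: "h \<in> frames V (X \<union> insert y Y)" "g = restrict h X"
        have im: "restrict h ?J ` ?J = h ` ?J" by auto
        have "h y \<notin> h ` ?J" using h(1) y by (auto simp: frames_def J inj_on_def)
        then have ind: "fvec.independent (h ` ?J)" "h y \<notin> fvec.span (h ` ?J)"
          using h(1) by (auto simp: frames_def J fvec.independent_insert)
        show "h y \<in> V" using h by (auto simp: frames_def J)
        show "restrict h ?J \<in> frames V ?J"
          unfolding frames_def using h(1) ind im
          by (auto simp: frames_def J inj_on_def)
        show "restrict (restrict h ?J) X = restrict h X"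
          by (auto simp: fun_eq_iff restrict_def)
        show "False" if "h y \<in> fvec.span (restrict h ?J ` ?J)" using that ind im by simp
      qed
    qed
    then have "card (?E (insert y Y)) = card ?S"
      by (simp add: bij_betw_same_card)
    also have "\<dots> = (\<Sum>f\<in>?E Y. card (V - fvec.span (f ` ?J)))"
      using V finX finY by (intro card_SigmaI) (auto simp: finite_frames)
    also have "\<dots> = (\<Sum>f\<in>?E Y. card V - CARD('a) ^ (card X + card Y))"
    proof (rule sum.cong[OF refl])
      fix f assume "f \<in> ?E Y"
      then have f: "f \<in> ?J \<rightarrow>\<^sub>E V" "inj_on f ?J" "fvec.independent (f ` ?J)" by (auto simp: frames_def)
      have "fvec.span (f ` ?J) \<subseteq> V" using f V by (intro fvec.span_minimal) auto
      moreover have "card (fvec.span (f ` ?J)) = CARD('a) ^ (card X + card Y)"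
        using f finX finY by (subst card_span_independent) (auto simp: card_image card_Un_disjoint simp del: image_Un)
      ultimately show "card (V - fvec.span (f ` ?J)) = card V - CARD('a) ^ (card X + card Y)"
        using V finite_subset by (subst card_Diff_subset) auto
    qed
    also have "\<dots> = (\<Prod>i\<in>{card X..<card X + card (insert y Y)}. card V - CARD('a) ^ i)"
      using IH insert.hyps by simp
    finally show ?case .
  qed
  from this[of "J - X"] show ?thesis
    using assms finX by (simp add: card_Diff_subset card_mono Un_absorb1)
qed

lemma card_frames:
  fixes V :: "(nat \<Rightarrow> 'a::{field,finite}) set"
  assumes "finite V" "fvec.subspace V" "finite J"
  shows "card (frames V J) = (\<Prod>i<card J. card V - CARD('a) ^ i)"
proof -
  \<comment> \<open>This is the only extensional function on the empty index set, so all frames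
    extend it.\<close>
  have "(\<lambda>_. undefined) \<in> frames V ({} :: 'b set)"
    by (auto simp: frames_def fvec.independent_empty)
  from card_frame_extensions[OF assms(1,2) this assms(3)] show ?thesis
    by (simp add: atLeast0LessThan restrict_def)
qed

text \<open>Choose an ordered basis of W indexed by X and extend it to J. Different choices on X
  have disjoint sets of extensions, so the two counts multiply.\<close>

lemma card_frames_span_ge:
  fixes V W :: "(nat \<Rightarrow> 'a::{field,finite}) set"
  assumes V: "finite V" "fvec.subspace V" and W: "fvec.subspace W" "W \<subseteq> V"
    and J: "finite J" "X \<subseteq> J" and X: "card X = fvec.dim W"
  shows "(\<Prod>i<card X. card W - CARD('a) ^ i) * (\<Prod>i\<in>{card X..<card J}. card V - CARD('a) ^ i)
    \<le> card {f \<in> frames V J. fvec.span (f ` X) = W}"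
proof -
  have fin: "finite X" "finite W" using assms finite_subset by blast+
  have sub: "frames W X \<subseteq> frames V X" using W by (auto simp: frames_def PiE_def)
  have span: "fvec.span (g ` X) = W" if "g \<in> frames W X" for g
  proof (rule card_subset_eq[OF fin(2)])
    have g: "g \<in> X \<rightarrow>\<^sub>E W" "inj_on g X" "fvec.independent (g ` X)" using that by (auto simp: frames_def)
    show "fvec.span (g ` X) \<subseteq> W" using g W by (intro fvec.span_minimal) auto
    show "card (fvec.span (g ` X)) = card W"
      using g fin W X by (simp add: card_span_independent card_image card_subspace)
  qed
  let ?E = "\<lambda>g. {f \<in> frames V J. restrict f X = g}"
  have "(\<Prod>i<card X. card W - CARD('a) ^ i) * (\<Prod>i\<in>{card X..<card J}. card V - CARD('a) ^ i)
    = (\<Sum>g\<in>frames W X. card (?E g))"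
    using sub card_frame_extensions[OF V _ J] card_frames[OF fin(2) W(1) fin(1)]
    by (simp add: subset_iff)
  also have "\<dots> = card (\<Union>g\<in>frames W X. ?E g)"
    using fin J V by (intro card_UN_disjoint[symmetric]) (auto simp: finite_frames)
  also have "\<dots> \<le> card {f \<in> frames V J. fvec.span (f ` X) = W}"
  proof (intro card_mono subsetI)
    fix f assume "f \<in> (\<Union>g\<in>frames W X. ?E g)"
    then have "f \<in> frames V J" "fvec.span (restrict f X ` X) = W" using span by (auto simp only: UN_iff mem_Collect_eq)
    then show "f \<in> {f \<in> frames V J. fvec.span (f ` X) = W}"
      by (metis (mono_tags, lifting) image_restrict_eq mem_Collect_eq)
  qed (use J V in \<open>simp add: finite_frames\<close>)
  finally show ?thesis .
qed

text \<open>If i lies in X but not in Y, equal spans would put \<open>f i\<close> into the span of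
  the other vectors of the frame. Injectivity is what carries an embedding into sets over to
  subspaces.\<close>

lemma inj_on_span_frame:
  assumes "f \<in> frames V J"
  shows "inj_on (\<lambda>X. fvec.span (f ` X)) (Pow J)"
proof -
  have "X \<subseteq> Y" if "X \<subseteq> J" "Y \<subseteq> J" "fvec.span (f ` X) = fvec.span (f ` Y)" for X Y
  proof
    fix i assume i: "i \<in> X"
    show "i \<in> Y"
    proof (rule ccontr)
      assume "i \<notin> Y"
      then have "f ` Y \<subseteq> f ` J - {f i}"
        using assms that(1,2) i unfolding frames_def inj_on_def by blast
      then have "fvec.span (f ` Y) \<subseteq> fvec.span (f ` J - {f i})" by (rule fvec.span_mono)
      moreover have "f i \<in> fvec.span (f ` Y)" using i that(3) fvec.span_base[of "f i" "f ` X"] by auto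
      moreover have "f i \<notin> fvec.span (f ` J - {f i})"
        using assms i that(1) by (auto simp: frames_def fvec.dependent_def)
      ultimately show False by blast
    qed
  qed
  then show ?thesis by (intro inj_onI) (metis PowD subset_antisym)
qed

subsection \<open>Gaussian binomial coefficients\<close>

text \<open>A factor q ^ i cancels. In the new form the numerators multiply to the number of
  independent j-tuples in dimension n, the denominators to the number of ordered bases in dimension
  j.\<close>

lemma gauss_binomial_eq_prod:
  assumes "q \<ge> 2" "j \<le> n"
  shows "gauss_binomial q n j = (\<Prod>i<j. (real q ^ n - real q ^ i) / (real q ^ j - real q ^ i))"
  unfolding gauss_binomial_def
proof (rule prod.cong[OF refl])
  fix i assume "i \<in> {..<j}"
  then have "real q ^ n - real q ^ i = real q ^ i * (real q ^ (n - i) - 1)"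
    "real q ^ j - real q ^ i = real q ^ i * (real q ^ (j - i) - 1)"
    using assms by (auto simp: right_diff_distrib simp flip: power_add)
  then show "(real q ^ (n - i) - 1) / (real q ^ (j - i) - 1)
      = (real q ^ n - real q ^ i) / (real q ^ j - real q ^ i)"
    using assms by simp
qed

lemma gauss_binomial_pos:
  assumes "q \<ge> 2" "j \<le> n"
  shows "gauss_binomial q n j > 0"
  unfolding gauss_binomial_def using assms by (intro prod_pos) (auto intro!: divide_pos_pos)

lemma gauss_binomial_Suc:
  assumes "q \<ge> 2" "j < n"
  shows "gauss_binomial q n (Suc j) * (real q ^ Suc j - 1) = gauss_binomial q n j * (real q ^ (n - j) - 1)"
proof -
  have "(\<Prod>i<Suc j. real q ^ (Suc j - i) - 1) = (real q ^ Suc j - 1) * (\<Prod>i<j. real q ^ (j - i) - 1)"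
    by (subst prod.lessThan_Suc_shift) simp
  moreover have "(\<Prod>i<j. real q ^ (j - i) - 1) > 0"
    using assms by (intro prod_pos) auto
  moreover have "real q ^ Suc j - 1 > 0" using assms by (simp del: power_Suc)
  ultimately show ?thesis
    by (simp add: gauss_binomial_def prod_dividef del: power_Suc)
qed

text \<open>By \<open>gauss_binomial_Suc\<close> neighbours have ratio (q ^ (n - j) - 1) / (q ^ (j +
  1) - 1), and q ^ a - 1 at least doubles when the exponent grows. For n - j = j + 1 the neighbours
  coincide, hence the middle claim without a factor 2.\<close>

lemma gauss_binomial_double:
  assumes "q \<ge> 2" "j < n"
  shows "Suc j < n - j \<Longrightarrow> 2 * gauss_binomial q n j \<le> gauss_binomial q n (Suc j)"
    and "n - j \<le> Suc j \<Longrightarrow> gauss_binomial q n (Suc j) \<le> gauss_binomial q n j"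
    and "n - j \<le> j \<Longrightarrow> 2 * gauss_binomial q n (Suc j) \<le> gauss_binomial q n j"
proof -
  have pos: "gauss_binomial q n j > 0" "gauss_binomial q n (Suc j) > 0"
    using assms by (auto intro: gauss_binomial_pos)
  have dbl: "2 * (real q ^ a - 1) \<le> real q ^ b - 1" if "a < b" for a b
  proof -
    have "2 * real q ^ a \<le> real q ^ Suc a" using assms by (simp add: mult_right_mono)
    also have "\<dots> \<le> real q ^ b" using assms that by (intro power_increasing) auto
    finally show ?thesis by simp
  qed
  have p: "real q ^ Suc j - 1 > 0" "real q ^ (n - j) - 1 > 0"
    using assms by (simp_all del: power_Suc)
  note eq = gauss_binomial_Suc[OF assms]
  show "2 * gauss_binomial q n j \<le> gauss_binomial q n (Suc j)" if "Suc j < n - j"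
  proof -
    have "(2 * gauss_binomial q n j) * (real q ^ Suc j - 1) = gauss_binomial q n j * (2 * (real q ^ Suc j - 1))" by simp
    also have "\<dots> \<le> gauss_binomial q n j * (real q ^ (n - j) - 1)"
      using dbl[OF that] pos by (intro mult_left_mono) auto
    finally show ?thesis using p by (simp add: eq[symmetric] del: power_Suc)
  qed
  show "gauss_binomial q n (Suc j) \<le> gauss_binomial q n j" if "n - j \<le> Suc j"
  proof -
    have "real q ^ (n - j) - 1 \<le> real q ^ Suc j - 1"
      using assms that by (intro diff_right_mono power_increasing) auto
    then have "gauss_binomial q n (Suc j) * (real q ^ (n - j) - 1) \<le> gauss_binomial q n j * (real q ^ (n - j) - 1)"
      using pos by (subst eq[symmetric]) (auto intro!: mult_left_mono)
    then show ?thesis using p by simp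
  qed
  show "2 * gauss_binomial q n (Suc j) \<le> gauss_binomial q n j" if "n - j \<le> j"
  proof -
    have "(2 * gauss_binomial q n (Suc j)) * (real q ^ (n - j) - 1) = gauss_binomial q n (Suc j) * (2 * (real q ^ (n - j) - 1))" by simp
    also have "\<dots> \<le> gauss_binomial q n (Suc j) * (real q ^ Suc j - 1)"
      using dbl[of "n - j" "Suc j"] that pos by (intro mult_left_mono) auto
    finally show ?thesis using p by (simp add: eq del: power_Suc)
  qed
qed

text \<open>Each step away from the middle gains a factor 2, except possibly the first step upwards:
  for odd n there are two equal middle coefficients. Hence the offset d + 1 above the
  middle.\<close>

lemma gauss_binomial_decay:
  assumes "q \<ge> 2"
  shows "n div 2 = j + d \<Longrightarrow> 2 ^ d * gauss_binomial q n j \<le> gauss_binomial q n (n div 2)"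
    and "n div 2 + d + 1 \<le> n \<Longrightarrow> 2 ^ d * gauss_binomial q n (n div 2 + d + 1) \<le> gauss_binomial q n (n div 2)"
proof -
  show "2 ^ d * gauss_binomial q n j \<le> gauss_binomial q n (n div 2)" if "n div 2 = j + d"
    using that
  proof (induction d arbitrary: j)
    case (Suc d)
    have "2 ^ Suc d * gauss_binomial q n j = 2 ^ d * (2 * gauss_binomial q n j)" by simp
    also have "\<dots> \<le> 2 ^ d * gauss_binomial q n (Suc j)"
      using Suc.prems by (intro mult_left_mono gauss_binomial_double(1)[OF assms]) auto
    also have "\<dots> \<le> gauss_binomial q n (n div 2)" using Suc by simp
    finally show ?case .
  qed simp
  show "2 ^ d * gauss_binomial q n (n div 2 + d + 1) \<le> gauss_binomial q n (n div 2)"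
    if "n div 2 + d + 1 \<le> n"
    using that
  proof (induction d)
    case 0
    then show ?case using gauss_binomial_double(2)[OF assms, of "n div 2" n] by simp
  next
    case (Suc d)
    let ?j = "n div 2 + d + 1"
    have "2 ^ Suc d * gauss_binomial q n (Suc ?j) = 2 ^ d * (2 * gauss_binomial q n (Suc ?j))" by simp
    also have "\<dots> \<le> 2 ^ d * gauss_binomial q n ?j"
      using Suc.prems by (intro mult_left_mono gauss_binomial_double(3)[OF assms]) auto
    also have "\<dots> \<le> gauss_binomial q n (n div 2)" using Suc by simp
    finally show ?case by simp
  qed
qed

lemma gauss_binomial_le_middle:
  assumes "q \<ge> 2" "j \<le> n" "j + d \<le> n div 2 \<or> n div 2 + d + 1 \<le> j"
  shows "2 ^ d * gauss_binomial q n j \<le> gauss_binomial q n (n div 2)"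
  using assms(3)
proof
  assume *: "j + d \<le> n div 2"
  have "2 ^ d * gauss_binomial q n j \<le> 2 ^ (n div 2 - j) * gauss_binomial q n j"
    using * gauss_binomial_pos[OF assms(1,2)] by (intro mult_right_mono power_increasing) auto
  also have "\<dots> \<le> gauss_binomial q n (n div 2)"
    using * by (intro gauss_binomial_decay(1)[OF assms(1)]) simp
  finally show ?thesis .
next
  assume *: "n div 2 + d + 1 \<le> j"
  define e where "e = j - n div 2 - 1"
  have e: "n div 2 + e + 1 = j" "d \<le> e" using * by (auto simp: e_def)
  have "2 ^ d * gauss_binomial q n j \<le> 2 ^ e * gauss_binomial q n j"
    using e gauss_binomial_pos[OF assms(1,2)] by (intro mult_right_mono power_increasing) auto
  also have "\<dots> \<le> gauss_binomial q n (n div 2)"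
    using gauss_binomial_decay(2)[OF assms(1), of n e] e(1) assms(2) by simp
  finally show ?thesis .
qed

subsection \<open>Averaging over ordered bases\<close>

text \<open>Inner levels have 2 ^ (k - 1) sets, and the middle coefficient is the largest. On outer
  levels one set suffices, because \<open>n \<ge> 4 * k\<close> puts them far enough from the middle
  for \<open>gauss_binomial_le_middle\<close> to gain 2 ^ (k - 1).\<close>

lemma level_weight_ge:
  assumes "q \<ge> 2" "k \<ge> 1" "n \<ge> 4 * k" "j \<le> n"
  shows "2 ^ (k - 1) / gauss_binomial q n (n div 2)
    \<le> real (card {p \<in> interval_chain k n. card (pset p) = j}) / gauss_binomial q n j"
proof -
  let ?N = "card {p \<in> interval_chain k n. card (pset p) = j}"
  have pos: "gauss_binomial q n (n div 2) > 0" "gauss_binomial q n j > 0"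
    using assms by (auto intro: gauss_binomial_pos)
  have "2 ^ (k - 1) * gauss_binomial q n j \<le> real ?N * gauss_binomial q n (n div 2)"
  proof (cases "k \<le> j \<and> j + k \<le> n")
    case True
    have "2 ^ (k - 1) \<le> ?N" using card_level_interval_chain(2) True assms by blast
    then have "2 ^ (k - 1) \<le> real ?N" by (metis of_nat_le_iff of_nat_numeral of_nat_power)
    moreover have "gauss_binomial q n j \<le> gauss_binomial q n (n div 2)"
      using gauss_binomial_le_middle[of q j n 0] assms by fastforce
    ultimately show ?thesis using pos by (intro mult_mono) auto
  next
    case False
    then have "2 ^ (k - 1) * gauss_binomial q n j \<le> 1 * gauss_binomial q n (n div 2)"
      using gauss_binomial_le_middle[of q j n "k - 1"] assms by force
    also have "\<dots> \<le> real ?N * gauss_binomial q n (n div 2)"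
      using card_level_interval_chain(1)[OF assms(4), of k] pos by (intro mult_right_mono) auto
    finally show ?thesis .
  qed
  then show ?thesis using pos by (simp add: field_simps)
qed

lemma card_coord_space: "card (coord_space n :: (nat \<Rightarrow> 'a::{field,finite}) set) = CARD('a) ^ n"
  by (simp add: card_subspace finite_coord_space subspace_coord_space dim_coord_space)

lemma card_field_ge_2: "CARD('a::{field,finite}) \<ge> 2"
  using card_mono[of UNIV "{0 :: 'a, 1}"] by simp

text \<open>The probability estimate behind the averaging, with the number of ordered bases as a
  factor instead of a divisor.\<close>

lemma prob_span_frame_ge:
  fixes W :: "(nat \<Rightarrow> 'a::{field,finite}) set"
  assumes W: "W \<in> subspaces n" and X: "X \<subseteq> {..<n}" "card X = fvec.dim W"
  shows "real (card (frames (coord_space n :: (nat \<Rightarrow> 'a) set) {..<n})) / gauss_binomial CARD('a) n (card X)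
    \<le> real (card {f \<in> frames (coord_space n) {..<n}. fvec.span (f ` X) = W})"
proof -
  let ?q = "CARD('a)" and ?V = "coord_space n :: (nat \<Rightarrow> 'a) set"
  let ?j = "card X"
  have q: "?q \<ge> 2" by (rule card_field_ge_2)
  have fin: "finite ?V" by (rule finite_coord_space)
  have W': "fvec.subspace W" "W \<subseteq> ?V" using W by (auto simp: subspaces_def)
  note cV = card_coord_space[of n, where 'a = 'a]
  have cW: "card W = ?q ^ ?j"
    using card_subspace[of W] W' X fin finite_subset by metis
  have jn: "?j \<le> n" using card_mono[OF _ X(1)] by simp
  have le: "?q ^ i \<le> ?q ^ m" if "i \<le> m" for i m using that q by (intro power_increasing) auto
  \<comment> \<open>\<open>?A\<close> counts the independent \<open>?j\<close>-tuples of the whole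
    space, \<open>?C\<close> the ordered bases of W, and \<open>?D\<close> the ways to complete such
    a tuple to a basis; \<open>?A / ?C\<close> is the Gaussian binomial.\<close>
  let ?A = "\<Prod>i<?j. real ?q ^ n - real ?q ^ i" and ?C = "\<Prod>i<?j. real ?q ^ ?j - real ?q ^ i"
  let ?D = "\<Prod>i\<in>{?j..<n}. real ?q ^ n - real ?q ^ i"
  have "real (card (frames ?V {..<n})) = (\<Prod>i<n. real ?q ^ n - real ?q ^ i)"
    using le by (simp add: card_frames fin subspace_coord_space cV of_nat_diff)
  also have "\<dots> = ?A * ?D"
    using prod.atLeastLessThan_concat[of 0 ?j n "\<lambda>i. real ?q ^ n - real ?q ^ i"] jn
    by (simp only: atLeast0LessThan)
  finally have frames: "real (card (frames ?V {..<n})) = ?A * ?D" .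
  have pos: "?A > 0" using q jn by (auto intro!: prod_pos power_strict_increasing)
  \<comment> \<open>As x / 0 = 0, this holds for c = 0 too, so only positivity of \<open>?A\<close>
    has to be supplied.\<close>
  have "a * d / (a / c) = c * d" if "a > 0" for a c d :: real using that by (cases "c = 0") auto
  then have "?A * ?D / gauss_binomial ?q n ?j = ?C * ?D"
    unfolding gauss_binomial_eq_prod[OF q jn] prod_dividef using pos by blast
  also have "\<dots> = real ((\<Prod>i<?j. card W - ?q ^ i) * (\<Prod>i\<in>{?j..<card {..<n}}. card ?V - ?q ^ i))"
    using le by (simp add: cV cW of_nat_diff)
  also have "\<dots> \<le> real (card {f \<in> frames ?V {..<n}. fvec.span (f ` X) = W})"
    using card_frames_span_ge[OF fin subspace_coord_space W' _ X] by (simp del: of_nat_mult)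
  finally show ?thesis by (simp add: frames)
qed

text \<open>Composing a greedy embedding of A into the interval chain with the map from sets to
  spans would give a copy of A in F. Ranks are at most \<open>height A r - 1\<close>, which is the
  number of discards.\<close>

lemma card_interval_chain_frame_le:
  fixes F :: "(nat \<Rightarrow> 'a::{field,finite}) set set"
  assumes k: "k \<ge> 2" and A: "finite A" "A \<noteq> {}" "partial_order_on A r"
    and free: "\<not> is_subposet A r F (relation_of (\<subseteq>) F)"
    and f: "f \<in> frames (coord_space n) {..<n}"
  shows "real (card {p \<in> interval_chain k n. fvec.span (f ` pset p) \<in> F})
    \<le> real (card A) + (3 * real k - 5) * 2 ^ (k - 2) * (real (height A r) - 1) - 1"
proof -
  let ?G = "{p \<in> interval_chain k n. fvec.span (f ` pset p) \<in> F}"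
  let ?D = "k * (2 ^ (k - 1) - 1) - 1"
  obtain \<rho> where \<rho>: "\<And>x. x \<in> A \<Longrightarrow> \<rho> x < height A r"
    "\<And>x y. x \<in> A \<Longrightarrow> y \<in> A \<Longrightarrow> (x, y) \<in> r \<Longrightarrow> x \<noteq> y \<Longrightarrow> \<rho> x < \<rho> y"
    using height_rank[OF A(1,3)] by metis
  have h: "height A r \<ge> 1" using \<rho>(1) A(2) by (metis One_nat_def Suc_leI ex_in_conv gr_implies_not0 neq0_conv)
  \<comment> \<open>This strict inequality yields the final - 1 of the bound.\<close>
  have "card ?G < card A + ?D * (height A r - 1)"
  proof (rule ccontr)
    assume "\<not> ?thesis"
    then have "card A + ?D * (height A r - 1) \<le> card ?G" by linarith
    moreover have "\<rho> x \<le> height A r - 1" if "x \<in> A" for x using \<rho>(1)[OF that] by linarith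
    ultimately obtain \<phi> where \<phi>: "inj_on \<phi> A" "\<phi> ` A \<subseteq> ?G"
        "\<forall>x\<in>A. \<forall>y\<in>A. \<rho> x < \<rho> y \<longrightarrow> pset (\<phi> x) \<subseteq> pset (\<phi> y)"
      using greedy_embedding[OF finite_interval_chain card_not_above_le[OF k] A(1), of n ?G \<rho> "height A r - 1"]
      by blast
    define \<psi> where "\<psi> x = fvec.span (f ` pset (\<phi> x))" for x
    have "inj_on \<psi> A"
    proof (rule inj_onI)
      fix x y assume xy: "x \<in> A" "y \<in> A" "\<psi> x = \<psi> y"
      then have "pset (\<phi> x) \<in> Pow {..<n}" "pset (\<phi> y) \<in> Pow {..<n}"
        using \<phi>(2) by (auto simp: interval_chain_def)
      then have "pset (\<phi> x) = pset (\<phi> y)"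
        using inj_onD[OF inj_on_span_frame[OF f]] xy(3) unfolding \<psi>_def by blast
      then show "x = y" using injD[OF inj_pset] inj_onD[OF \<phi>(1)] xy by blast
    qed
    moreover have \<psi>F: "\<psi> ` A \<subseteq> F" using \<phi>(2) by (auto simp: \<psi>_def)
    moreover have "(\<psi> x, \<psi> y) \<in> relation_of (\<subseteq>) F" if "x \<in> A" "y \<in> A" "(x, y) \<in> r" for x y
    proof -
      have "pset (\<phi> x) \<subseteq> pset (\<phi> y)" using \<rho>(2) \<phi>(3) that by (cases "x = y") auto
      then have "\<psi> x \<subseteq> \<psi> y" unfolding \<psi>_def by (intro fvec.span_mono image_mono)
      then show ?thesis using \<psi>F that by (auto simp: relation_of_def)
    qed
    ultimately have "is_subposet A r F (relation_of (\<subseteq>) F)" unfolding is_subposet_def by blast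
    then show False using free by simp
  qed
  then have *: "card ?G + 1 \<le> card A + ?D * (height A r - 1)" by linarith
  have "real (card ?G) + 1 \<le> real (card A) + real ?D * (real (height A r) - 1)"
  proof -
    have "real (card ?G + 1) \<le> real (card A + ?D * (height A r - 1))" using * by (rule of_nat_mono)
    then show ?thesis using h by (simp only: of_nat_add of_nat_mult of_nat_diff of_nat_1)
  qed
  moreover have "real ?D * (real (height A r) - 1) \<le> (3 * real k - 5) * 2 ^ (k - 2) * (real (height A r) - 1)"
    using discard_bound[OF k] h by (intro mult_right_mono) auto
  ultimately show ?thesis by linarith
qed

text \<open>Double counting of the pairs (f, p) whose span lies in F. Each member of F accounts for
  at least the fraction \<open>2 ^ (k - 1) / ?g (n div 2)\<close> of the number of bases, and each
  basis f for at most \<open>\<beta>\<close> pairs.\<close>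

lemma subposet_free_family_bound:
  fixes F :: "(nat \<Rightarrow> 'a::{field,finite}) set set"
  assumes k: "k \<ge> 2" and A: "finite A" "A \<noteq> {}" "partial_order_on A r"
    and F: "F \<subseteq> subspaces n" and free: "\<not> is_subposet A r F (relation_of (\<subseteq>) F)"
    and n: "n \<ge> 4 * k"
  shows "real (card F) \<le> 1 / 2 ^ (k - 1)
      * (real (card A) + (3 * real k - 5) * 2 ^ (k - 2) * (real (height A r) - 1) - 1)
      * gauss_binomial CARD('a) n (n div 2)"
proof -
  let ?q = "CARD('a)" and ?V = "coord_space n :: (nat \<Rightarrow> 'a) set" and ?C = "interval_chain k n"
  let ?Fr = "frames ?V {..<n}" and ?g = "gauss_binomial ?q n"
  define \<beta> where "\<beta> = real (card A) + (3 * real k - 5) * 2 ^ (k - 2) * (real (height A r) - 1) - 1"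
  have q: "?q \<ge> 2" by (rule card_field_ge_2)
  have finF: "finite F" using F finite_subspaces finite_subset by blast
  have finFr: "finite ?Fr" by (simp add: finite_frames finite_coord_space)
  have mid: "?g (n div 2) > 0" using q by (intro gauss_binomial_pos) auto
  have "real (card F) * (2 ^ (k - 1) / ?g (n div 2)) * real (card ?Fr)
    = (\<Sum>W\<in>F. 2 ^ (k - 1) / ?g (n div 2) * real (card ?Fr))" by simp
  also have "\<dots> \<le> (\<Sum>W\<in>F. \<Sum>p\<in>?C. real (card {f \<in> ?Fr. fvec.span (f ` pset p) = W}))"
  proof (rule sum_mono)
    fix W assume "W \<in> F"
    then have W: "W \<in> subspaces n" using F by blast
    let ?L = "{p \<in> ?C. card (pset p) = fvec.dim W}"
    have dim: "fvec.dim W \<le> n"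
    proof -
      have "card W \<le> card ?V" using W finite_coord_space by (intro card_mono) (auto simp: subspaces_def)
      then have "?q ^ fvec.dim W \<le> ?q ^ n"
        using W card_subspace[of W] card_coord_space[where 'a = 'a] finite_coord_space[of n] finite_subset[of W ?V]
        unfolding subspaces_def by (metis (no_types, lifting) mem_Collect_eq)
      then show ?thesis using q by (simp add: power_le_imp_le_exp)
    qed
    have "2 ^ (k - 1) / ?g (n div 2) * real (card ?Fr) \<le> real (card ?L) / ?g (fvec.dim W) * real (card ?Fr)"
      using k n dim q by (intro mult_right_mono level_weight_ge) auto
    also have "\<dots> = (\<Sum>p\<in>?L. real (card ?Fr) / ?g (card (pset p)))" by simp
    also have "\<dots> \<le> (\<Sum>p\<in>?L. real (card {f \<in> ?Fr. fvec.span (f ` pset p) = W}))"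
      using W by (intro sum_mono prob_span_frame_ge) (auto simp: interval_chain_def)
    also have "\<dots> \<le> (\<Sum>p\<in>?C. real (card {f \<in> ?Fr. fvec.span (f ` pset p) = W}))"
      using finite_interval_chain by (intro sum_mono2) auto
    finally show "2 ^ (k - 1) / ?g (n div 2) * real (card ?Fr) \<le> \<dots>" .
  qed
  \<comment> \<open>Indicators allow f to move outermost; for fixed f and p the sum over W is then 1
    exactly when the span lies in F.\<close>
  also have "\<dots> = (\<Sum>W\<in>F. \<Sum>p\<in>?C. \<Sum>f\<in>?Fr. if fvec.span (f ` pset p) = W then 1 else 0)"
    using finFr by (simp add: sum.If_cases Int_def)
  also have "\<dots> = (\<Sum>W\<in>F. \<Sum>f\<in>?Fr. \<Sum>p\<in>?C. if fvec.span (f ` pset p) = W then 1 else 0)"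
    by (intro sum.cong refl sum.swap)
  also have "\<dots> = (\<Sum>f\<in>?Fr. \<Sum>W\<in>F. \<Sum>p\<in>?C. if fvec.span (f ` pset p) = W then 1 else 0)"
    by (rule sum.swap)
  also have "\<dots> = (\<Sum>f\<in>?Fr. \<Sum>p\<in>?C. \<Sum>W\<in>F. if fvec.span (f ` pset p) = W then 1 else 0)"
    by (intro sum.cong refl sum.swap)
  also have "\<dots> = (\<Sum>f\<in>?Fr. real (card {p \<in> ?C. fvec.span (f ` pset p) \<in> F}))"
    using finF finite_interval_chain[of k n] by (simp add: sum.If_cases Int_def)
  also have "\<dots> \<le> (\<Sum>f\<in>?Fr. \<beta>)"
    unfolding \<beta>_def by (intro sum_mono card_interval_chain_frame_le[OF k A free])
  also have "\<dots> = \<beta> * real (card ?Fr)" by simp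
  finally have le: "real (card F) * (2 ^ (k - 1) / ?g (n div 2)) * real (card ?Fr) \<le> \<beta> * real (card ?Fr)" .
  \<comment> \<open>An ordered basis exists, so the common factor cancels.\<close>
  have "card ?Fr > 0"
    using q by (auto simp: card_frames finite_coord_space subspace_coord_space card_coord_space
        intro!: prod_pos power_strict_increasing)
  then have "real (card F) * (2 ^ (k - 1) / ?g (n div 2)) \<le> \<beta>"
    by (intro mult_right_le_imp_le[OF le]) simp
  then have "real (card F) \<le> 1 / 2 ^ (k - 1) * \<beta> * ?g (n div 2)"
    using mid by (simp add: field_simps)
  then show ?thesis unfolding \<beta>_def .
qed

theorem theorem17:
  fixes q k :: nat and A :: "'p set" and r :: "'p rel"
  assumes "primepow q" and "CARD('a::{field,finite}) = q"
    and "finite A" and "A \<noteq> {}" and "partial_order_on A r"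
    and "k \<ge> 2"
  shows "\<exists>N. \<forall>n\<ge>N. real (La TYPE('a) n A r)
    \<le> 1 / 2 ^ (k - 1)
        * (real (card A) + (3 * real k - 5) * 2 ^ (k - 2) * (real (height A r) - 1) - 1)
        * gauss_binomial q n (n div 2)"
proof (intro exI allI impI)
  \<comment> \<open>The threshold is N = 4 * k, the hypothesis under which the outer levels are
    controlled.\<close>
  fix n assume n: "4 * k \<le> n"
  let ?S = "{card F | F :: (nat \<Rightarrow> 'a) set set.
     F \<subseteq> subspaces n \<and> \<not> is_subposet A r F (relation_of (\<subseteq>) F)}"
  have "?S \<subseteq> card ` Pow (subspaces n :: (nat \<Rightarrow> 'a) set set)" by blast
  then have "finite ?S" using finite_subspaces finite_subset by blast
  \<comment> \<open>The empty family contains no copy of a nonempty poset, so the maximum is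
    attained by some family.\<close>
  moreover have "0 \<in> ?S"
    using assms(4) by (intro CollectI exI[of _ "{}"]) (auto simp: is_subposet_def)
  ultimately have "La TYPE('a) n A r \<in> ?S" unfolding La_def by (intro Max_in) auto
  then obtain F :: "(nat \<Rightarrow> 'a) set set" where "La TYPE('a) n A r = card F" "F \<subseteq> subspaces n"
    "\<not> is_subposet A r F (relation_of (\<subseteq>) F)" by blast
  then show "real (La TYPE('a) n A r)
    \<le> 1 / 2 ^ (k - 1)
        * (real (card A) + (3 * real k - 5) * 2 ^ (k - 2) * (real (height A r) - 1) - 1)
        * gauss_binomial q n (n div 2)"
    using subposet_free_family_bound[OF assms(6,3-5), of F n] n assms(2) by simp
qed

end
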